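(* Let $P=\{P_t\}_{t\in\mathbb{N}_0}$ be an $\{\mathcal{F}_{[0,t]}\}_{t\in\mathbb{N}_0}$-adapted stochastic process taking values in $[0,1]$ such that the following three conditions hold. 1. (Non-summable relative hazard rates) For every $t\in\mathbb{N}_0$ there is an $\mathcal{F}_{[0,t]}$-measurable random variable $\delta_t>0$ with $$\mathbb{E}_t[P_{t+1}]-P_t\ \ge\ \delta_t P_t(1-P_t),$$ and $\sum_{t=0}^\infty\delta_t=\infty$. 2. (WBERHR stretchable) There exist a random variable $\tilde\delta>0$ and an almost surely non-increasing sequence $\theta=\{\theta_t\}_{t\in\mathbb{N}_0}$ of $\mathcal{F}_{[0,t]}$-measurable random variables $\theta_t\in(0,1]$ such that $$-P_t\ \le\ \frac{1}{\theta_t}(P_{t+1}-P_t)\ \le\ 1-P_t\qquad\text{and}\qquad \frac{\delta_t}{\theta_t}>\tilde\delta$$ for all $t\in\mathbb{N}_0$. 3. (Relatively fast shrinking) For every $y\in\mathbb{R}$, the stopping time $\rho:=\min\{t\in\mathbb{N}_0: P_t\ge y\,\theta_t\}$ (with $\min\emptyset:=\infty$) is almost surely finite. Then $\lim_{t\uparrow\infty}P_t=1$ almost surely.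
   Context: Setting. $(\Omega,\mathcal{F})=(\prod_{t=1}^\infty\Omega_t,\otimes_{t=1}^\infty\mathcal{F}_t)$ is a product of measurable spaces with a probability measure $\mathbb{P}$. For $t\in\mathbb{N}$, $\mathcal{F}_{[0,t]}$ denotes the sigma-algebra on $\Omega$ generated by the first $t$ coordinates (i.e. $\otimes_{\tau=1}^t\mathcal{F}_\tau$), and $\mathcal{F}_{[0,0]}=\{\emptyset,\Omega\}$. $\mathbb{E}_t[\cdot]$ is conditional expectation given $\mathcal{F}_{[0,t]}$. $\mathbb{N}_0=\{0,1,2,\dots\}$. (In)equalities between random variables are meant almost surely. The random variable $\tilde\delta$ is only required to be $\mathcal{F}$-measurable and need not be bounded away from zero. *)

theory Defs
  imports "HOL-Probability.Probability"
begin

text \<open>The coordinates are indexed by \<open>1, 2, 3, \<dots>\<close>. The factor spaces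
  \<open>S 1, S 2, \<dots>\<close> are arbitrary measurable spaces over one type \<open>'a\<close> (only the space and the
  measurable sets of \<open>S t\<close> are used, its measure is irrelevant). For \<open>t = 0\<close> the index set
  \<open>{1..t}\<close> is empty and the result is the trivial sigma-algebra.\<close>

definition coord_filtration :: "(nat \<Rightarrow> 'a measure) \<Rightarrow> nat \<Rightarrow> (nat \<Rightarrow> 'a) measure" where
  "coord_filtration S t =
     vimage_algebra (space (PiM {1..} S)) (\<lambda>\<omega>. restrict \<omega> {1..t}) (PiM {1..t} S)"

text \<open>On \<open>enat\<close>, the infimum of a nonempty set is its minimum and \<open>Inf {} = \<infinity>\<close>.\<close>

definition reach_time ::
    "(nat \<Rightarrow> 'b \<Rightarrow> real) \<Rightarrow> (nat \<Rightarrow> 'b \<Rightarrow> real) \<Rightarrow> real \<Rightarrow> 'b \<Rightarrow> enat" where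
  "reach_time P \<theta> y \<omega> = Inf {enat t | t. P t \<omega> \<ge> y * \<theta> t \<omega>}"

lemma sets_coord_filtration:
  "sets (coord_filtration S t) =
     {(\<lambda>\<omega>. restrict \<omega> {1..t}) -` A \<inter> space (PiM {1..} S) | A. A \<in> sets (PiM {1..t} S)}"
  unfolding coord_filtration_def
  by (rule sets_vimage_algebra2) (auto simp: space_PiM PiE_iff)

lemma sets_coord_filtration_0:
  "sets (coord_filtration S 0) = {{}, space (PiM {1..} S)}"
  unfolding sets_coord_filtration
  by (auto simp: sets_PiM_empty restrict_def)

lemma subalgebra_coord_filtration:
  assumes "sets M = sets (PiM {1..} S)"
  shows "subalgebra M (coord_filtration S t)"
proof -
  have "(\<lambda>\<omega>. restrict \<omega> {1..t}) \<in> PiM {1..} S \<rightarrow>\<^sub>M PiM {1..t} S"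
    by (rule measurable_restrict_subset) auto
  then have "sets (coord_filtration S t) \<subseteq> sets (PiM {1..} S)"
    unfolding sets_coord_filtration by (auto intro: measurable_sets)
  then show ?thesis
    using assms sets_eq_imp_space_eq[OF assms]
    by (simp add: subalgebra_def coord_filtration_def)
qed

lemma reach_time_finite_iff:
  "reach_time P \<theta> y \<omega> < \<infinity> \<longleftrightarrow> (\<exists>t. P t \<omega> \<ge> y * \<theta> t \<omega>)"
  unfolding reach_time_def Inf_less_iff by force

end

theory Submission
  imports Defs
begin

text \<open>Only the maximal inequality for non-negative supermartingales is needed, applied on the
  event that the process stays in a suitable adapted region. It shows that a supermartingale
  whose infimum vanishes tends to 0, and that it is bounded almost surely.

  Since \<open>1 - P\<close> is a supermartingale, either \<open>P\<close> tends to 1 or \<open>P \<le> 1 - \<eta>\<close> at all times for some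
  \<open>\<eta> > 0\<close>. In the latter case take \<open>c > 0\<close> with \<open>\<delta> \<ge> c \<theta>\<close>: by convexity of \<open>exp\<close> and the two-sided
  bound on the increments, \<open>exp (- c \<eta> P / \<theta>)\<close> is a supermartingale, whose infimum vanishes by the
  shrinking condition; hence \<open>P / \<theta>\<close> tends to infinity. Once \<open>P / \<theta>\<close> is large, the drift dominates
  the variance and \<open>1 / P\<close> is a supermartingale, so \<open>P\<close> stays away from 0. But the sum of
  \<open>\<delta> P (1 - P)\<close> is almost surely finite, which contradicts the divergence of the sum of \<open>\<delta>\<close>.\<close>

section \<open>One-step estimates\<close>

text \<open>Convexity of \<open>exp\<close>: between \<open>- r\<close> and \<open>0\<close> the
  graph lies below the chord.\<close>

lemma exp_chord_bound:
  fixes r u :: real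
  assumes "0 \<le> u" "u \<le> 1"
  shows "exp (- (r * u)) \<le> 1 - (1 - exp (- r)) * u"
proof -
  have "exp ((1 - u) *\<^sub>R 0 + u *\<^sub>R (- r)) \<le> (1 - u) * exp 0 + u * exp (- r)"
    by (rule convex_onD[OF exp_convex]) (use assms in auto)
  then show ?thesis by (simp add: algebra_simps)
qed

text \<open>The right side is a nonnegative weight, built from the present values \<open>p\<close>
  and \<open>\<theta>\<close>, times drift bound minus increment. By the hazard condition that
  difference has nonpositive conditional mean, so a pointwise bound of this shape integrates to the
  supermartingale inequality.\<close>

lemma exp_step:
  fixes p p' d \<theta> \<theta>' c \<eta> r :: real
  assumes p: "0 \<le> p" "p \<le> 1 - \<eta>" and p': "0 \<le> p'"
    and \<theta>: "0 < \<theta>'" "\<theta>' \<le> \<theta>"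
    and step: "- p \<le> (p' - p) / \<theta>" "(p' - p) / \<theta> \<le> 1 - p"
    and d: "c * \<theta> \<le> d" and c: "0 \<le> c" "0 \<le> \<eta>" and r: "r = c * \<eta>"
  shows "exp (- (r * p' / \<theta>')) - exp (- (r * p / \<theta>))
    \<le> exp (- (r * p / \<theta>)) * exp (r * p) * (1 - exp (- r)) / \<theta> * (d * p * (1 - p) - (p' - p))"
proof -
  \<comment> \<open>The two-sided increment bound says exactly that \<open>u\<close> lies in
    \<open>{0..1}\<close>. Since \<open>p' / \<theta> = p / \<theta> - p + u\<close>, the chord
    bound for \<open>exp (- (r * u))\<close> makes the estimate affine in the increment.\<close>
  define v k u where "v = exp (- (r * p / \<theta>))" and "k = 1 - exp (- r)"
    and "u = p + (p' - p) / \<theta>"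
  have r0: "r \<ge> 0" and th: "\<theta> > 0" using assms by auto
  have v: "v > 0" and k0: "k \<ge> 0" using r0 by (auto simp: v_def k_def)
  have "exp (- r) \<le> 1 / (1 + r)"
    using exp_ge_add_one_self[of r] r0 by (simp add: exp_minus field_simps)
  then have k: "r \<le> k * (1 + r)" using r0 by (simp add: k_def field_simps)
  have "r * p' / \<theta> \<le> r * p' / \<theta>'"
    using \<theta> p' r0 by (intro divide_left_mono) auto
  then have "exp (- (r * p' / \<theta>')) \<le> exp (- (r * p' / \<theta>))" by simp
  also have "\<dots> = v * exp (r * p) * exp (- (r * u))"
    using th by (simp add: v_def u_def mult_exp_exp field_simps)
  also have "\<dots> \<le> v * exp (r * p) * (1 - k * u)"
    using exp_chord_bound[of u r] step v by (intro mult_left_mono) (auto simp: u_def k_def)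
  finally have 1: "exp (- (r * p' / \<theta>')) \<le> v * exp (r * p) * (1 - k * u)" .
  \<comment> \<open>The drift divided by \<open>\<theta>\<close> is at least
    \<open>c * \<eta>\<close> times \<open>p\<close>, because \<open>p\<close> keeps distance
    \<open>\<eta>\<close> from 1. This fixes the exponent \<open>r\<close>.\<close>
  have "r \<le> d / \<theta> * (1 - p)"
  proof -
    have "c \<le> d / \<theta>" using d th by (simp add: field_simps)
    then show ?thesis unfolding r using c p by (intro mult_mono) auto
  qed
  then have "k * p * r \<le> k * p * (d / \<theta> * (1 - p))"
    using k0 p by (intro mult_left_mono) auto
  moreover have "r * p \<le> k * (1 + r) * p" using k p by (intro mult_right_mono) auto
  moreover have "1 - r * p \<le> exp (- (r * p))" using exp_ge_add_one_self[of "- (r * p)"] by simp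
  \<comment> \<open>If the increment equalled the drift bound, the chord estimate would not exceed
    \<open>exp (- (r * p))\<close>: it is at most \<open>1 - k * (1 + r) * p\<close>, and
    \<open>k * (1 + r) \<ge> r\<close>.\<close>
  ultimately have "1 - k * p - k * p * (d / \<theta> * (1 - p)) \<le> exp (- (r * p))"
    by (simp add: algebra_simps)
  then have "v * exp (r * p) * (1 - k * p - k * p * (d / \<theta> * (1 - p))) \<le> v * exp (r * p) * exp (- (r * p))"
    using v by (intro mult_left_mono) auto
  also have "\<dots> = v" by (simp add: mult_exp_exp mult.assoc)
  finally have 2: "v * exp (r * p) * (1 - k * p - k * p * (d / \<theta> * (1 - p))) \<le> v" .
  have 3: "v * exp (r * p) * (1 - k * u) - v * exp (r * p) * (1 - k * p - k * p * (d / \<theta> * (1 - p)))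
    = v * exp (r * p) * k / \<theta> * (d * p * (1 - p) - (p' - p))"
    using th by (simp add: u_def field_simps)
  show ?thesis using diff_mono[OF 1 2] unfolding 3 unfolding v_def k_def .
qed

text \<open>Expand \<open>1 / p' - 1 / p = - (p' - p) / p^2 + (p' - p)^2 / (p^2 * p')\<close> and
  bound the square by an affine function of the increment. Then \<open>K * h\<close> is the
  resulting coefficient of \<open>- (p' - p)\<close>, and the constant remainder is a variance term
  that the drift absorbs once \<open>p / \<theta>\<close> is at least \<open>y\<close>.\<close>

lemma reciprocal_step:
  fixes p p' d \<theta> c y K :: real
  assumes p: "y * \<theta> \<le> p" "p \<le> 1" and K: "0 < K" "1 < K * p"
    and \<theta>: "0 < \<theta>"
    and step: "- p \<le> (p' - p) / \<theta>" "(p' - p) / \<theta> \<le> 1 - p"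
    and d: "c * \<theta> \<le> d" and c: "0 < c" and y: "2 \<le> y" "2 * (1 + c) \<le> c * y"
  defines "h \<equiv> (1 / p^2 - \<theta> * (1 - 2 * p) / (p^3 * (1 - \<theta>))) / K"
  shows "1 / max 1 (K * p') - 1 / max 1 (K * p) \<le> h * (d * p * (1 - p) - (p' - p))"
    and "0 \<le> h" and "h \<le> (K^2 + K^3) / K"
proof -
  define D where "D = (p' - p) / \<theta>"
  have \<theta>D: "p' - p = \<theta> * D" using \<theta> by (simp add: D_def)
  have "0 < K * p" using K by linarith
  then have p0: "p > 0" using K by (simp add: zero_less_mult_iff)
  \<comment> \<open>With \<open>p \<le> 1\<close> this keeps \<open>1 - \<theta>\<close> above
    \<open>1 / 2\<close>, so that \<open>q\<close> is comparable to \<open>\<theta>\<close> and does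
    not exceed \<open>p\<close>.\<close>
  have "2 * \<theta> \<le> y * \<theta>" using y \<theta> by (intro mult_right_mono) auto
  then have th2: "\<theta> \<le> 1 / 2" "2 * \<theta> \<le> p" using p by auto
  define q where "q = \<theta> / (1 - \<theta>)"
  have q0: "q > 0" using \<theta> th2 by (simp add: q_def)
  have q2: "q \<le> 2 * \<theta>"
  proof -
    have "\<theta> * 1 \<le> \<theta> * (2 * (1 - \<theta>))" using th2 \<theta> by (intro mult_left_mono) auto
    then show ?thesis unfolding q_def using th2 by (simp add: field_simps)
  qed
  have qp: "q \<le> p" "q * y \<le> 2 * p"
  proof -
    show "q \<le> p" using q2 th2 by simp
    have "q * y \<le> 2 * \<theta> * y" using q2 y by (intro mult_right_mono) auto
    also have "\<dots> \<le> 2 * p" using p by (simp add: mult_ac)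
    finally show "q * y \<le> 2 * p" .
  qed
  \<comment> \<open>The lower bound on \<open>c * y\<close> is made for this inequality, which lets
    the drift dominate the variance term below.\<close>
  have qc: "q * (1 + c) \<le> c * p"
  proof -
    have "q * (2 * (1 + c)) \<le> q * (c * y)" using y q0 by (intro mult_left_mono) auto
    also have "\<dots> = c * (q * y)" by simp
    also have "\<dots> \<le> c * (2 * p)" using qp c by (intro mult_left_mono) auto
    finally show ?thesis by (simp add: algebra_simps)
  qed
  have h_eq: "K * h = (p - q * (1 - 2 * p)) / p^3"
    using p0 K th2 by (simp add: h_def q_def power2_eq_square power3_eq_cube divide_simps)
  have "q * (1 - 2 * p) \<le> q * 1" using q0 p0 by (intro mult_left_mono) auto
  then have num: "0 \<le> p - q * (1 - 2 * p)" using qp by simp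
  have Kh: "0 \<le> K * h" unfolding h_eq using num p0 by (intro divide_nonneg_pos) auto
  then show h0: "0 \<le> h" using K by (simp add: zero_le_mult_iff)
  \<comment> \<open>\<open>D\<close> lies between \<open>- p\<close> and \<open>1 - p\<close>, so
    the product of its distances to the two endpoints is nonnegative. This trades the square for an
    affine function of \<open>D\<close>.\<close>
  have Dsq: "D\<^sup>2 \<le> p * (1 - p) + (1 - 2 * p) * D"
  proof -
    have "0 \<le> (D + p) * (1 - p - D)" using step by (intro mult_nonneg_nonneg) (auto simp: D_def)
    then show ?thesis by (simp add: algebra_simps power2_eq_square)
  qed
  have "\<theta> * (- p) \<le> \<theta> * D" using step \<theta> by (intro mult_left_mono) (auto simp: D_def)
  then have p'lb: "p * (1 - \<theta>) \<le> p'" using \<theta>D by (simp add: algebra_simps)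
  have "0 < p * (1 - \<theta>)" using p0 th2 by simp
  then have p'0: "p' > 0" using p'lb by linarith
  have "1 / p' - 1 / p = - (p' - p) / p^2 + (\<theta> * D)^2 / (p^2 * p')"
    unfolding \<theta>D[symmetric] using p0 p'0 by (simp add: field_simps power2_eq_square)
  also have "(\<theta> * D)^2 / (p^2 * p') \<le> (\<theta> * D)^2 / (p^2 * (p * (1 - \<theta>)))"
    using p'lb p0 p'0 th2 by (intro divide_left_mono mult_left_mono) auto
  also have "(\<theta> * D)^2 / (p^2 * (p * (1 - \<theta>))) = q * \<theta> * D\<^sup>2 / p^3"
    by (simp add: q_def power2_eq_square power3_eq_cube mult_ac)
  also have "q * \<theta> * D\<^sup>2 / p^3 \<le> q * \<theta> * (p * (1 - p) + (1 - 2 * p) * D) / p^3"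
    using Dsq q0 \<theta> p0 by (intro divide_right_mono mult_left_mono) auto
  finally have A: "1 / p' - 1 / p \<le> - (p' - p) / p^2 + q * \<theta> * (p * (1 - p) + (1 - 2 * p) * D) / p^3"
    by simp
  also have "\<dots> = q * \<theta> * p * (1 - p) / p^3 - K * h * (p' - p)"
    unfolding h_eq \<theta>D using p0 by (simp add: field_simps power2_eq_square power3_eq_cube)
  also have "q * \<theta> * p * (1 - p) / p^3 \<le> K * h * (d * p * (1 - p))"
  proof -
    have "q * (1 + c * (1 - 2 * p)) \<le> q * (1 + c)" 
      using q0 c p0 by (intro mult_left_mono) (auto simp: algebra_simps)
    then have "q \<le> c * (p - q * (1 - 2 * p))" using qc by (simp add: algebra_simps)
    then have "q * \<theta> \<le> c * (p - q * (1 - 2 * p)) * \<theta>" using \<theta> by (intro mult_right_mono) auto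
    also have "\<dots> = (p - q * (1 - 2 * p)) * (c * \<theta>)" by simp
    also have "\<dots> \<le> (p - q * (1 - 2 * p)) * d" using d num by (intro mult_left_mono) auto
    finally have "q * \<theta> * (p * (1 - p)) / p^3 \<le> (p - q * (1 - 2 * p)) * d * (p * (1 - p)) / p^3"
      using p p0 by (intro divide_right_mono mult_right_mono) auto
    then show ?thesis unfolding h_eq by (simp add: mult_ac)
  qed
  finally have B: "1 / p' - 1 / p \<le> K * (h * (d * p * (1 - p) - (p' - p)))"
    by (simp add: algebra_simps)
  \<comment> \<open>Since \<open>1 < K * p\<close>, the truncation is inactive at \<open>p\<close>;
    at \<open>p'\<close> it can only lower the reciprocal.\<close>
  have "1 / max 1 (K * p') - 1 / max 1 (K * p) \<le> 1 / (K * p') - 1 / (K * p)"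
    using K p'0 by (intro diff_mono divide_left_mono) auto
  also have "\<dots> = (1 / p' - 1 / p) / K" by (simp add: diff_divide_distrib mult.commute)
  also have "\<dots> \<le> h * (d * p * (1 - p) - (p' - p))"
    using B K by (simp add: field_simps)
  finally show "1 / max 1 (K * p') - 1 / max 1 (K * p) \<le> h * (d * p * (1 - p) - (p' - p))" .
  \<comment> \<open>The constant bound on \<open>h\<close> will supply integrability.\<close>
  have inv: "1 / p \<le> K" using K p0 by (simp add: field_simps)
  have i2: "(1 / p)^2 \<le> K^2" and i3: "(1 / p)^3 \<le> K^3"
    using inv p0 by (auto intro!: power_mono)
  have "q * (2 * p - 1) \<le> q * 1" using p q0 by (intro mult_left_mono) auto
  then have "p - q * (1 - 2 * p) \<le> p + 1" using qp p by (simp add: algebra_simps)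
  then have "K * h \<le> (p + 1) / p^3" unfolding h_eq using p0 by (intro divide_right_mono) auto
  also have "\<dots> = (1 / p)^2 + (1 / p)^3"
    using p0 by (simp add: field_simps power2_eq_square power3_eq_cube)
  finally show "h \<le> (K^2 + K^3) / K" using i2 i3 K by (simp add: field_simps)
qed

section \<open>Supermartingales on a region\<close>

locale filtered_prob_space = prob_space M for M :: "'a measure" +
  fixes F :: "nat \<Rightarrow> 'a measure"
  assumes subalg: "subalgebra M (F t)"
    and filtration: "sets (F t) \<subseteq> sets (F (Suc t))"
begin

lemma sets_F_imp_events: "B \<in> sets (F t) \<Longrightarrow> B \<in> events"
  using subalg[of t] by (auto simp: subalgebra_def)

lemma measurable_F_imp_M: "f \<in> borel_measurable (F t) \<Longrightarrow> f \<in> borel_measurable M"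
  using measurable_from_subalg[OF subalg] by blast

lemma space_F [simp]: "space (F t) = space M"
  using subalg[of t] by (auto simp: subalgebra_def)

text \<open>Continuity of the measure from below along the growing windows
  \<open>{n..n+k}\<close>.\<close>

lemma prob_bounded_ex_limit:
  fixes n :: nat
  assumes "\<And>k. \<P>(\<omega> in M. \<exists>T\<in>{n..n+k}. Q T \<omega>) \<le> C"
    and "\<And>T. {\<omega> \<in> space M. Q T \<omega>} \<in> events"
  shows "\<P>(\<omega> in M. \<exists>T\<ge>n. Q T \<omega>) \<le> C"
proof -
  let ?E = "\<lambda>k. {\<omega> \<in> space M. \<exists>T\<in>{n..n+k}. Q T \<omega>}"
  have "?E k \<in> events" for k
    using assms(2) by (intro sets.sets_Collect_finite_Ex) simp_all
  then have lim: "(\<lambda>k. prob (?E k)) \<longlonglongrightarrow> prob (\<Union>k. ?E k)"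
    by (intro finite_Lim_measure_incseq) (auto simp: incseq_def intro!: bexI)
  have eq: "(\<Union>k. ?E k) = {\<omega> \<in> space M. \<exists>T\<ge>n. Q T \<omega>}"
  proof (intro set_eqI iffI)
    fix \<omega> assume "\<omega> \<in> {\<omega> \<in> space M. \<exists>T\<ge>n. Q T \<omega>}"
    then obtain T where "\<omega> \<in> space M" "n \<le> T" "Q T \<omega>" by blast
    then have "\<omega> \<in> ?E T" by auto
    then show "\<omega> \<in> (\<Union>k. ?E k)" by blast
  qed auto
  show ?thesis
    using LIMSEQ_le_const2[OF lim[unfolded eq]] assms(1) by blast
qed

text \<open>The supermartingale inequality in integrated form, demanded only on
  \<open>F t\<close>-events inside \<open>A t\<close>. Consequently the process stopped on leaving
  the region is a nonnegative supermartingale, and no stopped process has to be constructed. For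
  \<open>A t = space M\<close> this is the usual notion.\<close>

definition nonneg_supermartingale_on :: "(nat \<Rightarrow> 'a set) \<Rightarrow> (nat \<Rightarrow> 'a \<Rightarrow> real) \<Rightarrow> bool" where
  "nonneg_supermartingale_on A X \<longleftrightarrow>
    (\<forall>t. A t \<in> sets (F t) \<and> X t \<in> borel_measurable (F t) \<and> integrable M (X t) \<and>
      (AE \<omega> in M. 0 \<le> X t \<omega>) \<and>
      (\<forall>B\<in>sets (F t). B \<subseteq> A t \<longrightarrow> (\<integral>\<omega>\<in>B. X (Suc t) \<omega> \<partial>M) \<le> (\<integral>\<omega>\<in>B. X t \<omega> \<partial>M)))"

section \<open>Maximal inequalities and convergence to 0 inside a region\<close>

context
  fixes A X
  assumes X: "nonneg_supermartingale_on A X"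
begin

lemma region_sets: "A t \<in> sets (F t)" and supermartingale_adapted: "X t \<in> borel_measurable (F t)"
  and supermartingale_integrable: "integrable M (X t)" and supermartingale_nonneg: "AE \<omega> in M. 0 \<le> X t \<omega>"
  and supermartingale_decreasing: "B \<in> sets (F t) \<Longrightarrow> B \<subseteq> A t \<Longrightarrow>
    (\<integral>\<omega>\<in>B. X (Suc t) \<omega> \<partial>M) \<le> (\<integral>\<omega>\<in>B. X t \<omega> \<partial>M)"
  using X by (auto simp: nonneg_supermartingale_on_def)

lemma region_events [measurable]: "A t \<in> events"
  using region_sets sets_F_imp_events by blast

lemma supermartingale_borel [measurable]: "X t \<in> borel_measurable M"
  using supermartingale_adapted measurable_F_imp_M by blast

lemma set_integrable_const: "C \<in> events \<Longrightarrow> set_integrable M C (\<lambda>_. b :: real)"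
  unfolding set_integrable_def by (intro integrable_mult_indicator) auto

lemma set_integrable_supermartingale: "B \<in> events \<Longrightarrow> set_integrable M B (X t)"
  unfolding set_integrable_def using supermartingale_integrable by (intro integrable_mult_indicator)

lemma mult_prob_le_set_integral:
  assumes "C \<in> events" "\<And>\<omega>. \<omega> \<in> C \<Longrightarrow> b \<le> X t \<omega>"
  shows "b * prob C \<le> (\<integral>\<omega>\<in>C. X t \<omega> \<partial>M)"
proof -
  have "b * prob C = (\<integral>\<omega>\<in>C. b \<partial>M)"
    using assms(1) by (simp add: set_lebesgue_integral_def)
  also have "\<dots> \<le> (\<integral>\<omega>\<in>C. X t \<omega> \<partial>M)"
    using assms by (intro set_integral_mono set_integrable_supermartingale set_integrable_const) auto
  finally show ?thesis .
qed

lemma set_integral_le_mult_prob: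
  assumes "C \<in> events" "\<And>\<omega>. \<omega> \<in> C \<Longrightarrow> X t \<omega> \<le> b"
  shows "(\<integral>\<omega>\<in>C. X t \<omega> \<partial>M) \<le> b * prob C"
proof -
  have "(\<integral>\<omega>\<in>C. X t \<omega> \<partial>M) \<le> (\<integral>\<omega>\<in>C. b \<partial>M)"
    using assms by (intro set_integral_mono set_integrable_supermartingale set_integrable_const) auto
  also have "\<dots> = b * prob C"
    using assms(1) by (simp add: set_lebesgue_integral_def)
  finally show ?thesis .
qed

lemma sublevel_sets:
  assumes "B \<in> sets (F n)"
  shows "{\<omega>\<in>B. lam \<le> X n \<omega>} \<in> sets (F n)" "{\<omega>\<in>B. X n \<omega> < lam} \<in> sets (F n)"
    "{\<omega>\<in>B. X n \<omega> \<le> lam} \<in> sets (F n)"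
proof -
  have [measurable]: "X n \<in> borel_measurable (F n)" "B \<in> sets (F n)"
    using supermartingale_adapted assms by auto
  have eq: "{\<omega>\<in>B. Q \<omega>} = B \<inter> {\<omega> \<in> space (F n). Q \<omega>}" for Q
    using sets.sets_into_space[OF assms] by auto
  show "{\<omega>\<in>B. lam \<le> X n \<omega>} \<in> sets (F n)" "{\<omega>\<in>B. X n \<omega> < lam} \<in> sets (F n)"
    "{\<omega>\<in>B. X n \<omega> \<le> lam} \<in> sets (F n)"
    unfolding eq by measurable
qed

lemma set_integral_supermartingale_mono:
  assumes [measurable]: "B \<in> events" "C \<in> events" and "B \<subseteq> C"
  shows "(\<integral>\<omega>\<in>B. X t \<omega> \<partial>M) \<le> (\<integral>\<omega>\<in>C. X t \<omega> \<partial>M)"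
  unfolding set_lebesgue_integral_def
  using set_integrable_supermartingale[of B t] set_integrable_supermartingale[of C t] supermartingale_nonneg[of t] assms
  by (intro integral_mono_AE) (auto simp: set_integrable_def indicator_def elim!: eventually_mono)

text \<open>Induction on the horizon, for all starting times and events at once, replaces optional
  stopping. Paths already above \<open>lam\<close> are counted by Markov's inequality. Of the others
  only those in \<open>A n\<close> can still contribute, and the supermartingale step compares their
  integrals at times \<open>Suc n\<close> and \<open>n\<close>. The time \<open>t\<close> itself is
  excluded from the region condition because the step into \<open>t\<close> starts from the previous
  time.\<close>

lemma maximal_inequality_bounded_horizon:
  assumes "B \<in> sets (F n)"
  shows "lam * \<P>(\<omega> in M. \<exists>t\<in>{n..n+k}. \<omega> \<in> B \<and> lam \<le> X t \<omega> \<and> (\<forall>s\<in>{n..<t}. \<omega> \<in> A s))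
    \<le> (\<integral>\<omega>\<in>B. X n \<omega> \<partial>M)"
  using assms
proof (induction k arbitrary: n B)
  case 0
  have [measurable]: "B \<in> events" using 0 sets_F_imp_events by blast
  let ?H = "{\<omega>\<in>B. lam \<le> X n \<omega>}"
  have H [measurable]: "?H \<in> events" using sublevel_sets[OF 0] sets_F_imp_events by blast
  have "lam * prob ?H \<le> (\<integral>\<omega>\<in>?H. X n \<omega> \<partial>M)"
    by (rule mult_prob_le_set_integral[OF H]) auto
  also have "\<dots> \<le> (\<integral>\<omega>\<in>B. X n \<omega> \<partial>M)"
    by (rule set_integral_supermartingale_mono) auto
  also have "?H = {\<omega> \<in> space M. \<exists>t\<in>{n..n+0}. \<omega> \<in> B \<and> lam \<le> X t \<omega> \<and> (\<forall>s\<in>{n..<t}. \<omega> \<in> A s)}"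
    using sets.sets_into_space[OF \<open>B \<in> events\<close>] by auto
  finally show ?case .
next
  case (Suc k)
  have B [measurable]: "B \<in> events" using Suc.prems sets_F_imp_events by blast
  let ?H = "{\<omega>\<in>B. lam \<le> X n \<omega>}" and ?L = "{\<omega>\<in>B. X n \<omega> < lam} \<inter> A n"
  let ?E = "\<lambda>n B k. {\<omega> \<in> space M. \<exists>t\<in>{n..n+k}. \<omega> \<in> B \<and> lam \<le> X t \<omega> \<and> (\<forall>s\<in>{n..<t}. \<omega> \<in> A s)}"
  have L: "?L \<in> sets (F n)" and H: "?H \<in> sets (F n)"
    using sublevel_sets[OF Suc.prems] region_sets by auto
  have Le [measurable]: "?L \<in> events" and He [measurable]: "?H \<in> events"
    using L H sets_F_imp_events by blast+
  have E: "?E n B (Suc k) = ?H \<union> ?E (Suc n) ?L k" (is "?lhs = ?rhs")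
  proof (intro set_eqI iffI)
    fix \<omega> assume "\<omega> \<in> ?lhs"
    then obtain t where t: "\<omega> \<in> space M" "n \<le> t" "t \<le> n + Suc k" "\<omega> \<in> B" "lam \<le> X t \<omega>"
      "\<forall>s\<in>{n..<t}. \<omega> \<in> A s" by auto
    show "\<omega> \<in> ?rhs"
    proof (cases "lam \<le> X n \<omega>")
      case False
      then have "t \<noteq> n" using t by auto
      then have "t \<in> {Suc n..Suc n + k}" "\<omega> \<in> A n" using t by auto
      then show ?thesis using t False by auto
    qed (use t in auto)
  next
    fix \<omega> assume "\<omega> \<in> ?rhs"
    then show "\<omega> \<in> ?lhs"
    proof
      assume "\<omega> \<in> ?H"
      then show ?thesis using sets.sets_into_space[OF B] by (auto intro!: bexI[of _ n])
    next
      assume "\<omega> \<in> ?E (Suc n) ?L k"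
      then obtain t where t: "\<omega> \<in> space M" "Suc n \<le> t" "t \<le> Suc n + k" "\<omega> \<in> ?L" "lam \<le> X t \<omega>"
        "\<forall>s\<in>{Suc n..<t}. \<omega> \<in> A s" by auto
      then have "\<forall>s\<in>{n..<t}. \<omega> \<in> A s"
        by (metis IntD2 atLeastLessThan_iff not_less_eq_eq order_antisym)
      then show ?thesis using t by (auto intro!: bexI[of _ t])
    qed
  qed
  have "prob (?E n B (Suc k)) = prob ?H + prob (?E (Suc n) ?L k)"
    unfolding E by (rule finite_measure_Union) (measurable, auto)
  then have "lam * prob (?E n B (Suc k)) = lam * prob ?H + lam * prob (?E (Suc n) ?L k)"
    by (simp add: algebra_simps)
  also have "lam * prob ?H \<le> (\<integral>\<omega>\<in>?H. X n \<omega> \<partial>M)"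
    by (rule mult_prob_le_set_integral[OF He]) auto
  also have "lam * prob (?E (Suc n) ?L k) \<le> (\<integral>\<omega>\<in>?L. X (Suc n) \<omega> \<partial>M)"
    using L filtration by (intro Suc.IH) blast
  also have "\<dots> \<le> (\<integral>\<omega>\<in>?L. X n \<omega> \<partial>M)"
    using L by (intro supermartingale_decreasing) auto
  \<comment> \<open>\<open>?H\<close> and \<open>?L\<close> are disjoint; the rest of
    \<open>B\<close> has left the region and may be added because \<open>X n\<close> is
    nonnegative.\<close>
  also have "(\<integral>\<omega>\<in>?H. X n \<omega> \<partial>M) + (\<integral>\<omega>\<in>?L. X n \<omega> \<partial>M) = (\<integral>\<omega>\<in>?H \<union> ?L. X n \<omega> \<partial>M)"
    using He Le by (intro set_integral_Un[symmetric] set_integrable_supermartingale) auto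
  also have "\<dots> \<le> (\<integral>\<omega>\<in>B. X n \<omega> \<partial>M)"
    using He Le by (intro set_integral_supermartingale_mono) auto
  finally show ?case by simp
qed

lemma maximal_inequality:
  assumes B: "B \<in> sets (F n)" and lam: "0 < lam"
  shows "lam * \<P>(\<omega> in M. \<exists>t\<ge>n. \<omega> \<in> B \<and> lam \<le> X t \<omega> \<and> (\<forall>s\<in>{n..<t}. \<omega> \<in> A s))
    \<le> (\<integral>\<omega>\<in>B. X n \<omega> \<partial>M)"
proof -
  have [measurable]: "B \<in> events" using B sets_F_imp_events by blast
  have "\<P>(\<omega> in M. \<exists>t\<ge>n. \<omega> \<in> B \<and> lam \<le> X t \<omega> \<and> (\<forall>s\<in>{n..<t}. \<omega> \<in> A s))
    \<le> (\<integral>\<omega>\<in>B. X n \<omega> \<partial>M) / lam"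
    using maximal_inequality_bounded_horizon[OF B, of lam] lam
    by (intro prob_bounded_ex_limit) (auto simp: field_simps)
  then show ?thesis using lam by (simp add: field_simps)
qed

text \<open>Split by the first time at which \<open>X\<close> is at most \<open>eps\<close>. The
  maximal inequality restarted there costs at most \<open>eps\<close> times the probability of that
  piece, and the pieces are disjoint subsets of \<open>B\<close>. The induction peels off the piece
  with first time \<open>n\<close>.\<close>

lemma return_inequality_bounded_horizon:
  assumes "B \<in> sets (F n)" and lam: "0 < lam" and eps: "0 < eps"
  shows "lam * \<P>(\<omega> in M. \<exists>T\<in>{n..n+k}. \<omega> \<in> B \<and> X T \<omega> \<le> eps \<and> (\<exists>t\<ge>T. lam \<le> X t \<omega>) \<and> (\<forall>s\<ge>n. \<omega> \<in> A s))
    \<le> eps * prob B"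
  using assms(1)
proof (induction k arbitrary: n B)
  case 0
  have [measurable]: "B \<in> events" using 0 sets_F_imp_events by blast
  let ?H = "{\<omega>\<in>B. X n \<omega> \<le> eps}"
  have H: "?H \<in> sets (F n)" using sublevel_sets[OF 0] by blast
  then have He [measurable]: "?H \<in> events" using sets_F_imp_events by blast
  have "lam * \<P>(\<omega> in M. \<exists>T\<in>{n..n+0}. \<omega> \<in> B \<and> X T \<omega> \<le> eps \<and> (\<exists>t\<ge>T. lam \<le> X t \<omega>) \<and> (\<forall>s\<ge>n. \<omega> \<in> A s))
    \<le> lam * \<P>(\<omega> in M. \<exists>t\<ge>n. \<omega> \<in> ?H \<and> lam \<le> X t \<omega> \<and> (\<forall>s\<in>{n..<t}. \<omega> \<in> A s))"
    using lam by (intro mult_left_mono finite_measure_mono) auto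
  also have "\<dots> \<le> (\<integral>\<omega>\<in>?H. X n \<omega> \<partial>M)" by (rule maximal_inequality[OF H lam])
  also have "\<dots> \<le> eps * prob ?H" by (rule set_integral_le_mult_prob[OF He]) auto
  also have "\<dots> \<le> eps * prob B" using eps by (intro mult_left_mono finite_measure_mono) auto
  finally show ?case .
next
  case (Suc k)
  have B [measurable]: "B \<in> events" using Suc.prems sets_F_imp_events by blast
  let ?H = "{\<omega>\<in>B. X n \<omega> \<le> eps}" and ?L = "B - {\<omega>\<in>B. X n \<omega> \<le> eps}"
  let ?E = "\<lambda>n B k. {\<omega> \<in> space M. \<exists>T\<in>{n..n+k}. \<omega> \<in> B \<and> X T \<omega> \<le> eps \<and> (\<exists>t\<ge>T. lam \<le> X t \<omega>) \<and> (\<forall>s\<ge>n. \<omega> \<in> A s)}"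
  let ?G = "{\<omega> \<in> space M. \<exists>t\<ge>n. \<omega> \<in> ?H \<and> lam \<le> X t \<omega> \<and> (\<forall>s\<in>{n..<t}. \<omega> \<in> A s)}"
  have H: "?H \<in> sets (F n)" and L: "?L \<in> sets (F n)"
    using sublevel_sets[OF Suc.prems] Suc.prems by auto
  have He [measurable]: "?H \<in> events" and Le [measurable]: "?L \<in> events"
    using H L sets_F_imp_events by blast+
  have E: "?E n B (Suc k) \<subseteq> ?G \<union> ?E (Suc n) ?L k"
  proof
    fix \<omega> assume "\<omega> \<in> ?E n B (Suc k)"
    then obtain T t where T: "\<omega> \<in> space M" "n \<le> T" "T \<le> n + Suc k" "\<omega> \<in> B" "X T \<omega> \<le> eps"
      "T \<le> t" "lam \<le> X t \<omega>" "\<forall>s\<ge>n. \<omega> \<in> A s" by auto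
    show "\<omega> \<in> ?G \<union> ?E (Suc n) ?L k"
    proof (cases "X n \<omega> \<le> eps")
      case True
      then have "\<omega> \<in> ?G" using T by (auto intro!: exI[of _ t])
      then show ?thesis by blast
    next
      case False
      then have "T \<noteq> n" using T by auto
      then have "T \<in> {Suc n..Suc n + k}" using T by auto
      then have "\<omega> \<in> ?E (Suc n) ?L k" using T False by (auto intro!: bexI[of _ T])
      then show ?thesis by blast
    qed
  qed
  have "lam * prob (?E n B (Suc k)) \<le> lam * (prob ?G + prob (?E (Suc n) ?L k))"
  proof (intro mult_left_mono order.trans[OF finite_measure_mono[OF E]] measure_Un_le)
  qed (use lam in \<open>auto | measurable\<close>)
  also have "\<dots> = lam * prob ?G + lam * prob (?E (Suc n) ?L k)" by (simp add: algebra_simps)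
  also have "lam * prob ?G \<le> (\<integral>\<omega>\<in>?H. X n \<omega> \<partial>M)" by (rule maximal_inequality[OF H lam])
  also have "\<dots> \<le> eps * prob ?H" by (rule set_integral_le_mult_prob[OF He]) auto
  also have "lam * prob (?E (Suc n) ?L k) \<le> eps * prob ?L"
    using L filtration by (intro Suc.IH) blast
  also have "eps * prob ?H + eps * prob ?L = eps * prob B"
  proof -
    have "?H \<subseteq> B" by auto
    then show ?thesis using finite_measure_Diff[OF B He] by (simp add: distrib_left[symmetric])
  qed
  finally show ?case by simp
qed

lemma return_inequality:
  assumes lam: "0 < lam" and eps: "0 < eps"
  shows "lam * \<P>(\<omega> in M. \<exists>T. X T \<omega> \<le> eps \<and> (\<exists>t\<ge>T. lam \<le> X t \<omega>) \<and> (\<forall>s. \<omega> \<in> A s)) \<le> eps"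
proof -
  have "\<P>(\<omega> in M. \<exists>T\<ge>0. X T \<omega> \<le> eps \<and> (\<exists>t\<ge>T. lam \<le> X t \<omega>) \<and> (\<forall>s. \<omega> \<in> A s)) \<le> eps / lam"
  proof (rule prob_bounded_ex_limit)
    fix k
    have "{\<omega> \<in> space M. \<exists>T\<in>{0..0+k}. \<omega> \<in> space M \<and> X T \<omega> \<le> eps \<and> (\<exists>t\<ge>T. lam \<le> X t \<omega>) \<and> (\<forall>s\<ge>0. \<omega> \<in> A s)}
      = {\<omega> \<in> space M. \<exists>T\<in>{0..0+k}. X T \<omega> \<le> eps \<and> (\<exists>t\<ge>T. lam \<le> X t \<omega>) \<and> (\<forall>s. \<omega> \<in> A s)}"
      by auto
    then show "\<P>(\<omega> in M. \<exists>T\<in>{0..0+k}. X T \<omega> \<le> eps \<and> (\<exists>t\<ge>T. lam \<le> X t \<omega>) \<and> (\<forall>s. \<omega> \<in> A s)) \<le> eps / lam"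
      using return_inequality_bounded_horizon[of "space M" 0 lam eps k] lam eps
        sets.top[of "F 0"] by (simp add: field_simps prob_space)
  qed measurable
  then show ?thesis using lam by (simp add: field_simps)
qed

text \<open>On paths that stay in the region, a value of at least \<open>1 / Suc m\<close> after a
  dip to \<open>1 / Suc j\<close> has probability at most \<open>Suc m / Suc j\<close>. A vanishing
  infimum provides dips of every depth, so letting \<open>j\<close> grow leaves a null set for each
  \<open>m\<close>.\<close>

lemma AE_tendsto_0_if_inf_0:
  "AE \<omega> in M. (\<forall>s. \<omega> \<in> A s) \<longrightarrow> (\<forall>j. \<exists>T. X T \<omega> \<le> 1 / Suc j) \<longrightarrow> (\<lambda>t. X t \<omega>) \<longlonglongrightarrow> 0"
proof -
  have null: "AE \<omega> in M. \<not> ((\<forall>s. \<omega> \<in> A s) \<and> (\<forall>j. \<exists>T. X T \<omega> \<le> 1 / Suc j) \<and>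
      (\<forall>n. \<exists>t\<ge>n. 1 / Suc m \<le> X t \<omega>))" for m
  proof -
    let ?Z = "{\<omega> \<in> space M. (\<forall>s. \<omega> \<in> A s) \<and> (\<forall>j. \<exists>T. X T \<omega> \<le> 1 / Suc j) \<and>
      (\<forall>n. \<exists>t\<ge>n. 1 / Suc m \<le> X t \<omega>)}"
    have "prob ?Z \<le> Suc m * inverse (Suc j)" for j
    proof -
      have "prob ?Z \<le> \<P>(\<omega> in M. \<exists>T. X T \<omega> \<le> 1 / Suc j \<and> (\<exists>t\<ge>T. 1 / Suc m \<le> X t \<omega>) \<and> (\<forall>s. \<omega> \<in> A s))"
        by (rule finite_measure_mono) (blast, measurable)
      also have "\<dots> \<le> Suc m * inverse (Suc j)"
        using return_inequality[of "1 / Suc m" "1 / Suc j"] by (simp add: field_simps)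
      finally show ?thesis .
    qed
    moreover have "(\<lambda>j. real (Suc m) * inverse (real (Suc j))) \<longlonglongrightarrow> real (Suc m) * 0"
      by (intro tendsto_intros LIMSEQ_inverse_real_of_nat)
    ultimately have "prob ?Z \<le> 0"
      using LIMSEQ_le_const[of "\<lambda>j. real (Suc m) * inverse (real (Suc j))" "real (Suc m) * 0" "prob ?Z"]
      by simp
    then have "prob ?Z = 0" using measure_nonneg[of M ?Z] by linarith
    then show ?thesis by (subst AE_iff_measurable[OF _ refl]) (measurable, simp add: emeasure_eq_measure)
  qed
  have "AE \<omega> in M. \<forall>t. 0 \<le> X t \<omega>" using supermartingale_nonneg by (simp add: AE_all_countable)
  moreover have "AE \<omega> in M. \<forall>m. \<not> ((\<forall>s. \<omega> \<in> A s) \<and> (\<forall>j. \<exists>T. X T \<omega> \<le> 1 / Suc j) \<and>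
      (\<forall>n. \<exists>t\<ge>n. 1 / Suc m \<le> X t \<omega>))"
    unfolding AE_all_countable using null by blast
  ultimately show ?thesis
  proof eventually_elim
    case (elim \<omega>)
    show ?case
    proof (intro impI LIMSEQ_I)
      assume inf: "\<forall>s. \<omega> \<in> A s" "\<forall>j. \<exists>T. X T \<omega> \<le> 1 / Suc j"
      fix e :: real assume "e > 0"
      then obtain m where m: "1 / Suc m < e" using nat_approx_posE by blast
      then obtain n where "\<forall>t\<ge>n. X t \<omega> < 1 / Suc m" using elim inf by (meson not_le)
      then show "\<exists>n. \<forall>t\<ge>n. norm (X t \<omega> - 0) < e" using elim m by (auto intro!: exI[of _ n])
    qed
  qed
qed

end
end

section \<open>Processes with a hazard rate\<close>

text \<open>Gathers the hypotheses on single time steps over an arbitrary filtration. The conditions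
  on whole paths (divergent sum, ratio bound, shrinking) are added in
  \<open>AE_tendsto_1\<close>.\<close>

locale hazard_process = filtered_prob_space M F
  for M :: "'a measure" and F :: "nat \<Rightarrow> 'a measure" +
  fixes P \<delta> \<theta> :: "nat \<Rightarrow> 'a \<Rightarrow> real"
  assumes P_adapted: "P t \<in> borel_measurable (F t)"
    and \<delta>_adapted: "\<delta> t \<in> borel_measurable (F t)"
    and \<theta>_adapted: "\<theta> t \<in> borel_measurable (F t)"
    and P_range: "AE \<omega> in M. P t \<omega> \<in> {0..1}"
    and \<delta>_pos: "AE \<omega> in M. \<delta> t \<omega> > 0"
    and hazard: "AE \<omega> in M. real_cond_exp M (F t) (P (Suc t)) \<omega> - P t \<omega>
      \<ge> \<delta> t \<omega> * P t \<omega> * (1 - P t \<omega>)"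
    and \<theta>_range: "AE \<omega> in M. \<theta> t \<omega> \<in> {0<..1}"
    and \<theta>_decreasing: "AE \<omega> in M. \<theta> (Suc t) \<omega> \<le> \<theta> t \<omega>"
    and stretch: "AE \<omega> in M. - P t \<omega> \<le> (P (Suc t) \<omega> - P t \<omega>) / \<theta> t \<omega> \<and>
      (P (Suc t) \<omega> - P t \<omega>) / \<theta> t \<omega> \<le> 1 - P t \<omega>"
begin

lemma process_measurable [measurable]:
  "P t \<in> borel_measurable M" "\<delta> t \<in> borel_measurable M" "\<theta> t \<in> borel_measurable M"
  using P_adapted \<delta>_adapted \<theta>_adapted measurable_F_imp_M by blast+

lemma P_integrable: "integrable M (P t)"
  using P_range[of t] by (intro integrable_const_bound[where B = 1]) auto

text \<open>Multiply the hazard inequality by the nonnegative \<open>F t\<close>-measurable weight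
  \<open>h\<close> on \<open>B\<close> and integrate: conditioning does not change the integral of
  \<open>h\<close> times the increment. The bound \<open>C\<close> is put on this product rather
  than on \<open>h\<close>, since a weight containing \<open>1 / \<theta> t\<close> may be
  unbounded.\<close>

lemma set_integral_decreasing:
  assumes B: "B \<in> sets (F t)" and h: "h \<in> borel_measurable (F t)"
    and int: "integrable M X" "integrable M X'"
    and AE: "AE \<omega> in M. \<omega> \<in> B \<longrightarrow> 0 \<le> h \<omega> \<and> \<bar>h \<omega> * (P (Suc t) \<omega> - P t \<omega>)\<bar> \<le> C \<and>
      X' \<omega> - X \<omega> \<le> h \<omega> * (\<delta> t \<omega> * P t \<omega> * (1 - P t \<omega>) - (P (Suc t) \<omega> - P t \<omega>))"
  shows "(\<integral>\<omega>\<in>B. X' \<omega> \<partial>M) \<le> (\<integral>\<omega>\<in>B. X \<omega> \<partial>M)"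
proof -
  interpret FM: finite_measure_subalgebra M "F t"
    by unfold_locales (rule subalg)
  let ?g = "\<lambda>\<omega>. indicator B \<omega> * h \<omega>" and ?f = "\<lambda>\<omega>. P (Suc t) \<omega> - P t \<omega>"
  have B_ev [measurable]: "B \<in> events" using B sets_F_imp_events by blast
  have hM [measurable]: "h \<in> borel_measurable M" using h measurable_F_imp_M by blast
  have g: "?g \<in> borel_measurable (F t)" using B h by measurable
  \<comment> \<open>Outside \<open>B\<close> the product is 0, so the absolute value of
    \<open>C\<close> serves as a bound that is nonnegative in any case.\<close>
  have gf: "integrable M (\<lambda>\<omega>. ?g \<omega> * ?f \<omega>)"
    using AE by (intro integrable_const_bound[where B = "\<bar>C\<bar>"])
      (auto simp: indicator_def elim!: eventually_mono)
  have gce: "integrable M (\<lambda>\<omega>. ?g \<omega> * real_cond_exp M (F t) ?f \<omega>)"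
    and eq: "(\<integral>\<omega>. ?g \<omega> * real_cond_exp M (F t) ?f \<omega> \<partial>M) = (\<integral>\<omega>. ?g \<omega> * ?f \<omega> \<partial>M)"
    using FM.real_cond_exp_intg[OF gf g] by auto
  have sint: "set_integrable M B X" "set_integrable M B X'"
    unfolding set_integrable_def using int B_ev by (blast intro: integrable_mult_indicator)+
  have "(\<integral>\<omega>\<in>B. X' \<omega> \<partial>M) - (\<integral>\<omega>\<in>B. X \<omega> \<partial>M) = (\<integral>\<omega>\<in>B. X' \<omega> - X \<omega> \<partial>M)"
    using sint by (simp add: set_integral_diff)
  also have "\<dots> \<le> (\<integral>\<omega>. ?g \<omega> * real_cond_exp M (F t) ?f \<omega> - ?g \<omega> * ?f \<omega> \<partial>M)"
    unfolding set_lebesgue_integral_def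
  proof (rule integral_mono_AE)
    show "integrable M (\<lambda>\<omega>. indicat_real B \<omega> *\<^sub>R (X' \<omega> - X \<omega>))"
      using set_integral_diff(1)[OF sint(2,1)] by (simp add: set_integrable_def)
    have "AE \<omega> in M. real_cond_exp M (F t) ?f \<omega> = real_cond_exp M (F t) (P (Suc t)) \<omega> - P t \<omega>"
      using FM.real_cond_exp_diff[OF P_integrable P_integrable, of "Suc t" t]
        FM.real_cond_exp_F_meas[OF P_integrable P_adapted] by eventually_elim simp
    then show "AE \<omega> in M. indicat_real B \<omega> *\<^sub>R (X' \<omega> - X \<omega>)
      \<le> ?g \<omega> * real_cond_exp M (F t) ?f \<omega> - ?g \<omega> * ?f \<omega>"
      using hazard[of t] AE
    proof eventually_elim
      case (elim \<omega>)
      show ?case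
      proof (cases "\<omega> \<in> B")
        case True
        then have "h \<omega> * (\<delta> t \<omega> * P t \<omega> * (1 - P t \<omega>)) \<le> h \<omega> * real_cond_exp M (F t) ?f \<omega>"
          using elim by (intro mult_left_mono) auto
        then have "h \<omega> * (\<delta> t \<omega> * P t \<omega> * (1 - P t \<omega>)) - h \<omega> * ?f \<omega>
          \<le> h \<omega> * real_cond_exp M (F t) ?f \<omega> - h \<omega> * ?f \<omega>" by (rule diff_right_mono)
        moreover have "X' \<omega> - X \<omega> \<le> h \<omega> * (\<delta> t \<omega> * P t \<omega> * (1 - P t \<omega>)) - h \<omega> * ?f \<omega>"
          using elim True by (simp only: right_diff_distrib[symmetric])
        ultimately show ?thesis using True by simp
      qed simp
    qed
  qed (use gf gce in auto)
  also have "\<dots> = 0" using gf gce eq by simp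
  finally show ?thesis by simp
qed

section \<open>Three supermartingales built from the process\<close>

lemma supermartingale_complement:
  "nonneg_supermartingale_on (\<lambda>_. space M) (\<lambda>t \<omega>. 1 - P t \<omega>)"
  unfolding nonneg_supermartingale_on_def
proof (intro allI conjI ballI impI)
  fix t B assume B: "B \<in> sets (F t)"
  \<comment> \<open>Constant weight 1 suffices because the drift bound is nonnegative.\<close>
  have "AE \<omega> in M. \<omega> \<in> B \<longrightarrow> 0 \<le> (1::real) \<and> \<bar>1 * (P (Suc t) \<omega> - P t \<omega>)\<bar> \<le> 1 \<and>
      (1 - P (Suc t) \<omega>) - (1 - P t \<omega>)
        \<le> 1 * (\<delta> t \<omega> * P t \<omega> * (1 - P t \<omega>) - (P (Suc t) \<omega> - P t \<omega>))"
    using P_range[of t] P_range[of "Suc t"] \<delta>_pos[of t] by eventually_elim auto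
  then show "(\<integral>\<omega>\<in>B. 1 - P (Suc t) \<omega> \<partial>M) \<le> (\<integral>\<omega>\<in>B. 1 - P t \<omega> \<partial>M)"
    by (intro set_integral_decreasing[OF B, of "\<lambda>_. 1"]) (auto simp: P_integrable)
next
  fix t
  show "space M \<in> sets (F t)" using sets.top[of "F t"] by simp
  show "AE \<omega> in M. 0 \<le> 1 - P t \<omega>" using P_range[of t] by eventually_elim auto
  show "(\<lambda>\<omega>. 1 - P t \<omega>) \<in> borel_measurable (F t)" using P_adapted[of t] by measurable
qed (auto simp: P_integrable)

lemma supermartingale_exp:
  assumes c: "0 \<le> c" and \<eta>: "0 \<le> \<eta>"
  shows "nonneg_supermartingale_on
    (\<lambda>t. {\<omega> \<in> space M. P t \<omega> \<le> 1 - \<eta> \<and> c * \<theta> t \<omega> \<le> \<delta> t \<omega>})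
    (\<lambda>t \<omega>. exp (- (c * \<eta> * P t \<omega> / \<theta> t \<omega>)))"
    (is "nonneg_supermartingale_on ?A ?X")
proof -
  have X_le: "AE \<omega> in M. ?X t \<omega> \<le> 1" for t
    using P_range[of t] \<theta>_range[of t] by eventually_elim (use c \<eta> in auto)
  have X_int: "integrable M (?X t)" for t
    using X_le[of t] by (intro integrable_const_bound[where B = 1]) auto
  show ?thesis
    unfolding nonneg_supermartingale_on_def
  proof (intro allI conjI ballI impI)
    fix t
    note [measurable] = P_adapted[of t] \<theta>_adapted[of t] \<delta>_adapted[of t]
    have "{\<omega> \<in> space (F t). P t \<omega> \<le> 1 - \<eta> \<and> c * \<theta> t \<omega> \<le> \<delta> t \<omega>} \<in> sets (F t)" by measurable
    then show "?A t \<in> sets (F t)" by simp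
    show "?X t \<in> borel_measurable (F t)" by measurable
    show "integrable M (?X t)" by (rule X_int)
    show "AE \<omega> in M. 0 \<le> ?X t \<omega>" by simp
    fix B assume B: "B \<in> sets (F t)" "B \<subseteq> ?A t"
    define r where "r = c * \<eta>"
    define h where "h \<omega> = exp (- (r * P t \<omega> / \<theta> t \<omega>)) * exp (r * P t \<omega>) * (1 - exp (- r)) / \<theta> t \<omega>" for \<omega>
    have r0: "0 \<le> r" using c \<eta> by (simp add: r_def)
    have h_meas: "h \<in> borel_measurable (F t)" unfolding h_def by measurable
    have "AE \<omega> in M. \<omega> \<in> B \<longrightarrow> 0 \<le> h \<omega> \<and> \<bar>h \<omega> * (P (Suc t) \<omega> - P t \<omega>)\<bar> \<le> exp r \<and>
      ?X (Suc t) \<omega> - ?X t \<omega> \<le> h \<omega> * (\<delta> t \<omega> * P t \<omega> * (1 - P t \<omega>) - (P (Suc t) \<omega> - P t \<omega>))"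
      using P_range[of t] P_range[of "Suc t"] \<theta>_range[of t] \<theta>_range[of "Suc t"] \<theta>_decreasing[of t] stretch[of t] X_le[of t]
    proof (eventually_elim, intro impI conjI)
      fix \<omega>
      assume as: "P t \<omega> \<in> {0..1}" "P (Suc t) \<omega> \<in> {0..1}" "\<theta> t \<omega> \<in> {0<..1}" "\<theta> (Suc t) \<omega> \<in> {0<..1}"
        "\<theta> (Suc t) \<omega> \<le> \<theta> t \<omega>" "?X t \<omega> \<le> 1" "\<omega> \<in> B"
        "- P t \<omega> \<le> (P (Suc t) \<omega> - P t \<omega>) / \<theta> t \<omega> \<and> (P (Suc t) \<omega> - P t \<omega>) / \<theta> t \<omega> \<le> 1 - P t \<omega>"
      show "0 \<le> h \<omega>" using as r0 by (simp add: h_def)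
      show "?X (Suc t) \<omega> - ?X t \<omega> \<le> h \<omega> * (\<delta> t \<omega> * P t \<omega> * (1 - P t \<omega>) - (P (Suc t) \<omega> - P t \<omega>))"
        unfolding h_def r_def using as c \<eta> B(2)
        by (intro exp_step[where c = c and \<eta> = \<eta>]) auto
      let ?D = "(P (Suc t) \<omega> - P t \<omega>) / \<theta> t \<omega>"
      have "0 \<le> P t \<omega>" "P t \<omega> \<le> 1" using as by auto
      then have D: "\<bar>?D\<bar> \<le> 1" using as(8) by linarith
      have "r * P t \<omega> \<le> r * 1" using as r0 by (intro mult_left_mono) auto
      then have e: "exp (r * P t \<omega>) \<le> exp r" by simp
      \<comment> \<open>The factor \<open>1 / \<theta> t\<close> of \<open>h\<close> is absorbed
        into the rescaled increment \<open>?D\<close>, which is at most 1 in absolute value.\<close>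
      have "\<bar>h \<omega> * (P (Suc t) \<omega> - P t \<omega>)\<bar> =
        exp (- (r * P t \<omega> / \<theta> t \<omega>)) * exp (r * P t \<omega>) * (1 - exp (- r)) * \<bar>?D\<bar>"
        using r0 by (simp add: h_def abs_mult)
      also have "\<dots> \<le> 1 * exp r * 1 * 1"
        using as e r0 D by (intro mult_mono) (auto simp: r_def)
      finally show "\<bar>h \<omega> * (P (Suc t) \<omega> - P t \<omega>)\<bar> \<le> exp r" by simp
    qed
    then show "(\<integral>\<omega>\<in>B. ?X (Suc t) \<omega> \<partial>M) \<le> (\<integral>\<omega>\<in>B. ?X t \<omega> \<partial>M)"
      by (rule set_integral_decreasing[OF B(1) h_meas X_int X_int])
  qed
qed

text \<open>Truncation makes the multiple \<open>1 / (K * P)\<close> of the reciprocal bounded.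
  Where \<open>K * P t\<close> is at most 1 the process sits at its maximum 1 and cannot increase,
  so weight 0 works; elsewhere \<open>reciprocal_step\<close> supplies the weight.\<close>

lemma supermartingale_reciprocal:
  assumes c: "0 < c" and y: "2 \<le> y" "2 * (1 + c) \<le> c * y" and K: "0 < K"
  shows "nonneg_supermartingale_on
    (\<lambda>t. {\<omega> \<in> space M. y * \<theta> t \<omega> \<le> P t \<omega> \<and> c * \<theta> t \<omega> \<le> \<delta> t \<omega>})
    (\<lambda>t \<omega>. 1 / max 1 (K * P t \<omega>))"
    (is "nonneg_supermartingale_on ?A ?X")
proof -
  have X_int: "integrable M (?X t)" for t
    by (intro integrable_const_bound[where B = 1]) auto
  show ?thesis
    unfolding nonneg_supermartingale_on_def
  proof (intro allI conjI ballI impI)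
    fix t
    note [measurable] = P_adapted[of t] \<theta>_adapted[of t] \<delta>_adapted[of t]
    have "{\<omega> \<in> space (F t). y * \<theta> t \<omega> \<le> P t \<omega> \<and> c * \<theta> t \<omega> \<le> \<delta> t \<omega>} \<in> sets (F t)" by measurable
    then show "?A t \<in> sets (F t)" by simp
    show "?X t \<in> borel_measurable (F t)" by measurable
    show "integrable M (?X t)" by (rule X_int)
    show "AE \<omega> in M. 0 \<le> ?X t \<omega>" by simp
    fix B assume B: "B \<in> sets (F t)" "B \<subseteq> ?A t"
    define h where "h \<omega> = (if 1 < K * P t \<omega> then
      (1 / (P t \<omega>)^2 - \<theta> t \<omega> * (1 - 2 * P t \<omega>) / ((P t \<omega>)^3 * (1 - \<theta> t \<omega>))) / K else 0)" for \<omega>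
    have h_meas: "h \<in> borel_measurable (F t)" unfolding h_def by measurable
    have "AE \<omega> in M. \<omega> \<in> B \<longrightarrow> 0 \<le> h \<omega> \<and> \<bar>h \<omega> * (P (Suc t) \<omega> - P t \<omega>)\<bar> \<le> (K^2 + K^3) / K \<and>
      ?X (Suc t) \<omega> - ?X t \<omega> \<le> h \<omega> * (\<delta> t \<omega> * P t \<omega> * (1 - P t \<omega>) - (P (Suc t) \<omega> - P t \<omega>))"
      using P_range[of t] P_range[of "Suc t"] \<theta>_range[of t] stretch[of t]
    proof (eventually_elim, intro impI)
      fix \<omega>
      assume as: "P t \<omega> \<in> {0..1}" "P (Suc t) \<omega> \<in> {0..1}" "\<theta> t \<omega> \<in> {0<..1}" "\<omega> \<in> B"
        "- P t \<omega> \<le> (P (Suc t) \<omega> - P t \<omega>) / \<theta> t \<omega> \<and> (P (Suc t) \<omega> - P t \<omega>) / \<theta> t \<omega> \<le> 1 - P t \<omega>"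
      show "0 \<le> h \<omega> \<and> \<bar>h \<omega> * (P (Suc t) \<omega> - P t \<omega>)\<bar> \<le> (K^2 + K^3) / K \<and>
        ?X (Suc t) \<omega> - ?X t \<omega> \<le> h \<omega> * (\<delta> t \<omega> * P t \<omega> * (1 - P t \<omega>) - (P (Suc t) \<omega> - P t \<omega>))"
      proof (cases "1 < K * P t \<omega>")
        case True
        have A: "y * \<theta> t \<omega> \<le> P t \<omega>" "c * \<theta> t \<omega> \<le> \<delta> t \<omega>" using as B by auto
        have "P t \<omega> \<le> 1" "0 < \<theta> t \<omega>" using as by auto
        note step = reciprocal_step[OF A(1) this(1) K True this(2) as(5)[THEN conjunct1]
          as(5)[THEN conjunct2] A(2) c y]
        have "\<bar>P (Suc t) \<omega> - P t \<omega>\<bar> \<le> 1" using as by auto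
        then have "\<bar>h \<omega> * (P (Suc t) \<omega> - P t \<omega>)\<bar> \<le> (K^2 + K^3) / K * 1"
          unfolding abs_mult using step(2,3) True by (intro mult_mono) (auto simp: h_def)
        then show ?thesis using step True by (simp add: h_def)
      next
        case False
        then show ?thesis using K by (auto simp: h_def max_def field_simps)
      qed
    qed
    then show "(\<integral>\<omega>\<in>B. ?X (Suc t) \<omega> \<partial>M) \<le> (\<integral>\<omega>\<in>B. ?X t \<omega> \<partial>M)"
      by (rule set_integral_decreasing[OF B(1) h_meas X_int X_int])
  qed
qed

section \<open>Almost sure behaviour of the paths\<close>

text \<open>Start from \<open>P n\<close> at least \<open>1 / Suc j\<close>. The truncated
  reciprocal with factor \<open>Suc K\<close> then begins at most at \<open>Suc j / Suc K\<close>,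
  and it equals 1 once \<open>P\<close> falls to \<open>1 / Suc K\<close>. By the maximal inequality
  at level 1 this has probability at most \<open>Suc j / Suc K\<close>, which vanishes as
  \<open>K\<close> grows.\<close>

lemma AE_bounded_away_from_0:
  assumes c: "0 < c" and y: "2 \<le> y" "2 * (1 + c) \<le> c * y"
  shows "AE \<omega> in M. 0 < P n \<omega> \<longrightarrow> (\<forall>t\<ge>n. y * \<theta> t \<omega> \<le> P t \<omega> \<and> c * \<theta> t \<omega> \<le> \<delta> t \<omega>) \<longrightarrow>
    (\<exists>K::nat. \<forall>t\<ge>n. 1 < Suc K * P t \<omega>)"
proof -
  let ?A = "\<lambda>t. {\<omega> \<in> space M. y * \<theta> t \<omega> \<le> P t \<omega> \<and> c * \<theta> t \<omega> \<le> \<delta> t \<omega>}"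
  have null: "AE \<omega> in M. \<not> (1 / Suc j \<le> P n \<omega> \<and>
      (\<forall>t\<ge>n. y * \<theta> t \<omega> \<le> P t \<omega> \<and> c * \<theta> t \<omega> \<le> \<delta> t \<omega>) \<and>
      (\<forall>K::nat. \<exists>t\<ge>n. Suc K * P t \<omega> \<le> 1))" for j
  proof -
    let ?Z = "{\<omega> \<in> space M. 1 / Suc j \<le> P n \<omega> \<and>
      (\<forall>t\<ge>n. y * \<theta> t \<omega> \<le> P t \<omega> \<and> c * \<theta> t \<omega> \<le> \<delta> t \<omega>) \<and>
      (\<forall>K::nat. \<exists>t\<ge>n. Suc K * P t \<omega> \<le> 1)}"
    let ?B = "{\<omega> \<in> space M. 1 / Suc j \<le> P n \<omega>}"
    have "{\<omega> \<in> space (F n). 1 / Suc j \<le> P n \<omega>} \<in> sets (F n)" using P_adapted[of n] by measurable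
    then have B: "?B \<in> sets (F n)" by simp
    have "prob ?Z \<le> Suc j * inverse (Suc K)" for K
    proof -
      have K: "0 < real (Suc K)" by simp
      note super = supermartingale_reciprocal[OF c y K]
      have "prob ?Z \<le> \<P>(\<omega> in M. \<exists>t\<ge>n. \<omega> \<in> ?B \<and> 1 \<le> 1 / max 1 (Suc K * P t \<omega>) \<and> (\<forall>s\<in>{n..<t}. \<omega> \<in> ?A s))"
      proof (rule finite_measure_mono)
        show "?Z \<subseteq> {\<omega> \<in> space M. \<exists>t\<ge>n. \<omega> \<in> ?B \<and> 1 \<le> 1 / max 1 (Suc K * P t \<omega>) \<and> (\<forall>s\<in>{n..<t}. \<omega> \<in> ?A s)}"
        proof
          fix \<omega> assume Z: "\<omega> \<in> ?Z"
          then obtain t where "t \<ge> n" "Suc K * P t \<omega> \<le> 1" by blast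
          then show "\<omega> \<in> {\<omega> \<in> space M. \<exists>t\<ge>n. \<omega> \<in> ?B \<and> 1 \<le> 1 / max 1 (Suc K * P t \<omega>) \<and> (\<forall>s\<in>{n..<t}. \<omega> \<in> ?A s)}"
            using Z by (auto intro!: exI[of _ t] simp: max_def)
        qed
      qed measurable
      also have "\<dots> \<le> (\<integral>\<omega>\<in>?B. 1 / max 1 (Suc K * P n \<omega>) \<partial>M)"
        using maximal_inequality[OF super B, of 1] by simp
      also have "\<dots> \<le> Suc j * inverse (Suc K) * prob ?B"
      proof (rule set_integral_le_mult_prob[OF super])
        fix \<omega> assume "\<omega> \<in> ?B"
        then have "1 / Suc j \<le> P n \<omega>" by simp
        then have "Suc K * (1 / Suc j) \<le> max 1 (Suc K * P n \<omega>)"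
          by (intro max.coboundedI2 mult_left_mono) auto
        then have "1 / max 1 (Suc K * P n \<omega>) \<le> 1 / (Suc K * (1 / Suc j))"
          by (intro divide_left_mono) auto
        then show "1 / max 1 (Suc K * P n \<omega>) \<le> Suc j * inverse (Suc K)"
          by (simp add: field_simps)
      qed measurable
      also have "\<dots> \<le> Suc j * inverse (Suc K) * 1"
        by (intro mult_left_mono) auto
      finally show ?thesis by simp
    qed
    moreover have "(\<lambda>K. real (Suc j) * inverse (real (Suc K))) \<longlonglongrightarrow> real (Suc j) * 0"
      by (intro tendsto_intros LIMSEQ_inverse_real_of_nat)
    ultimately have "prob ?Z \<le> 0"
      using LIMSEQ_le_const[of "\<lambda>K. real (Suc j) * inverse (real (Suc K))" "real (Suc j) * 0" "prob ?Z"]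
      by simp
    then have "prob ?Z = 0" using measure_nonneg[of M ?Z] by linarith
    then show ?thesis by (subst AE_iff_measurable[OF _ refl]) (measurable, simp add: emeasure_eq_measure)
  qed
  have "AE \<omega> in M. \<forall>j. \<not> (1 / Suc j \<le> P n \<omega> \<and>
      (\<forall>t\<ge>n. y * \<theta> t \<omega> \<le> P t \<omega> \<and> c * \<theta> t \<omega> \<le> \<delta> t \<omega>) \<and>
      (\<forall>K::nat. \<exists>t\<ge>n. Suc K * P t \<omega> \<le> 1))"
    unfolding AE_all_countable using null by blast
  then show ?thesis
  proof eventually_elim
    case (elim \<omega>)
    show ?case
    proof (intro impI)
      assume "0 < P n \<omega>" and large: "\<forall>t\<ge>n. y * \<theta> t \<omega> \<le> P t \<omega> \<and> c * \<theta> t \<omega> \<le> \<delta> t \<omega>"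
      then obtain j where "1 / Suc j < P n \<omega>" using nat_approx_posE by blast
      then show "\<exists>K::nat. \<forall>t\<ge>n. 1 < Suc K * P t \<omega>"
        using elim large by (meson less_imp_le not_le)
    qed
  qed
qed

text \<open>The expected drift at time \<open>t\<close> is at most the growth of the expectation of
  \<open>P\<close>. These growths telescope to at most 1, so the sum of the drifts has finite
  expectation.\<close>

lemma AE_summable_hazard: "AE \<omega> in M. summable (\<lambda>t. \<delta> t \<omega> * P t \<omega> * (1 - P t \<omega>))"
proof -
  let ?D = "\<lambda>t \<omega>. \<delta> t \<omega> * P t \<omega> * (1 - P t \<omega>)"
  have D_le: "(\<integral>\<^sup>+\<omega>. ennreal (?D t \<omega>) \<partial>M) \<le> ennreal (expectation (P (Suc t)) - expectation (P t))"
    and D_nonneg: "AE \<omega> in M. 0 \<le> ?D t \<omega>" for t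
  proof -
    interpret FM: finite_measure_subalgebra M "F t"
      by unfold_locales (rule subalg)
    let ?G = "\<lambda>\<omega>. real_cond_exp M (F t) (P (Suc t)) \<omega> - P t \<omega>"
    show D0: "AE \<omega> in M. 0 \<le> ?D t \<omega>"
      using P_range[of t] \<delta>_pos[of t] by eventually_elim auto
    have G0: "AE \<omega> in M. 0 \<le> ?G \<omega>" using D0 hazard[of t] by eventually_elim auto
    have G_int: "integrable M ?G" using FM.real_cond_exp_int(1)[OF P_integrable] P_integrable by simp
    have "(\<integral>\<^sup>+\<omega>. ennreal (?D t \<omega>) \<partial>M) \<le> (\<integral>\<^sup>+\<omega>. ennreal (?G \<omega>) \<partial>M)"
      using hazard[of t] by (intro nn_integral_mono_AE) (auto elim!: eventually_mono intro!: ennreal_leI)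
    also have "\<dots> = ennreal (\<integral>\<omega>. ?G \<omega> \<partial>M)" by (rule nn_integral_eq_integral[OF G_int G0])
    also have "(\<integral>\<omega>. ?G \<omega> \<partial>M) = expectation (P (Suc t)) - expectation (P t)"
      using FM.real_cond_exp_int[OF P_integrable[of "Suc t"]] P_integrable by simp
    finally show "(\<integral>\<^sup>+\<omega>. ennreal (?D t \<omega>) \<partial>M) \<le> ennreal (expectation (P (Suc t)) - expectation (P t))" .
  qed
  have E_range: "0 \<le> expectation (P t)" "expectation (P t) \<le> 1" for t
  proof -
    show "0 \<le> expectation (P t)" using P_range[of t] by (intro integral_nonneg_AE) auto
    show "expectation (P t) \<le> 1" using P_range[of t] by (intro integral_le_const P_integrable) auto
  qed
  have E_mono: "expectation (P t) \<le> expectation (P (Suc t))" for t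
    using supermartingale_decreasing[OF supermartingale_complement sets.top, of t]
    by (simp add: set_integral_space P_integrable)
  have partial: "(\<Sum>t<n. \<integral>\<^sup>+\<omega>. ennreal (?D t \<omega>) \<partial>M) \<le> 1" for n
  proof -
    have "(\<Sum>t<n. \<integral>\<^sup>+\<omega>. ennreal (?D t \<omega>) \<partial>M)
      \<le> (\<Sum>t<n. ennreal (expectation (P (Suc t)) - expectation (P t)))"
      by (intro sum_mono D_le)
    also have "\<dots> = ennreal (\<Sum>t<n. expectation (P (Suc t)) - expectation (P t))"
      using E_mono by (intro sum_ennreal) auto
    also have "\<dots> = ennreal (expectation (P n) - expectation (P 0))" 
      using sum_lessThan_telescope[of "\<lambda>t. expectation (P t)" n] by simp
    also have "\<dots> \<le> ennreal 1" using E_range[of 0] E_range[of n] by (intro ennreal_leI) auto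
    finally show ?thesis by simp
  qed
  have "(\<integral>\<^sup>+\<omega>. (\<Sum>t. ennreal (?D t \<omega>)) \<partial>M) = (\<Sum>t. \<integral>\<^sup>+\<omega>. ennreal (?D t \<omega>) \<partial>M)"
    by (intro nn_integral_suminf) measurable
  also have "\<dots> \<le> 1" using partial by (intro suminf_le_const) auto
  finally have "(\<integral>\<^sup>+\<omega>. (\<Sum>t. ennreal (?D t \<omega>)) \<partial>M) \<noteq> \<infinity>" by (auto simp: top_unique)
  then have "AE \<omega> in M. (\<Sum>t. ennreal (?D t \<omega>)) \<noteq> \<infinity>"
    by (intro nn_integral_PInf_AE) measurable
  moreover have "AE \<omega> in M. \<forall>t. 0 \<le> ?D t \<omega>" using D_nonneg by (simp add: AE_all_countable)
  ultimately show ?thesis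
    by eventually_elim (auto intro!: summable_suminf_not_top)
qed

text \<open>The almost sure statements are gathered over countable families of constants; the
  remaining argument concerns a single path and is by contradiction.\<close>

theorem AE_tendsto_1:
  assumes sum: "AE \<omega> in M. \<not> summable (\<lambda>t. \<delta> t \<omega>)"
    and ratio: "AE \<omega> in M. \<exists>c>0. \<forall>t. c * \<theta> t \<omega> \<le> \<delta> t \<omega>"
    and shrink: "\<And>y. AE \<omega> in M. \<exists>t. y * \<theta> t \<omega> \<le> P t \<omega>"
  shows "AE \<omega> in M. (\<lambda>t. P t \<omega>) \<longlonglongrightarrow> 1"
proof -
  \<comment> \<open>\<open>c\<close> serves both as the ratio bound and as the distance from 1;
    \<open>y i\<close> is chosen so that \<open>2 * (1 + c i) = c i * y i\<close>.\<close>
  define c :: "nat \<Rightarrow> real" where "c i = 1 / Suc i" for i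
  define y :: "nat \<Rightarrow> real" where "y i = 2 * (real (Suc i) + 1)" for i
  have c0: "c i > 0" and y2: "2 \<le> y i" and cy: "2 * (1 + c i) \<le> c i * y i" for i
    by (auto simp: c_def y_def field_simps)
  have "AE \<omega> in M. \<forall>t. P t \<omega> \<in> {0..1} \<and> 0 < \<delta> t \<omega> \<and> \<theta> t \<omega> \<in> {0<..1}"
    using P_range \<delta>_pos \<theta>_range by (simp add: AE_all_countable)
  moreover have "AE \<omega> in M. \<forall>k::nat. \<exists>t. real k * \<theta> t \<omega> \<le> P t \<omega>"
    using shrink by (simp add: AE_all_countable)
  moreover note AE_tendsto_0_if_inf_0[OF supermartingale_complement]
  moreover have "AE \<omega> in M. \<forall>i j. (\<forall>s. \<omega> \<in> {\<omega> \<in> space M. P s \<omega> \<le> 1 - c j \<and> c i * \<theta> s \<omega> \<le> \<delta> s \<omega>}) \<longrightarrow>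
      (\<forall>m. \<exists>T. exp (- (c i * c j * P T \<omega> / \<theta> T \<omega>)) \<le> 1 / Suc m) \<longrightarrow>
      (\<lambda>t. exp (- (c i * c j * P t \<omega> / \<theta> t \<omega>))) \<longlonglongrightarrow> 0"
    using AE_tendsto_0_if_inf_0[OF supermartingale_exp[OF less_imp_le[OF c0] less_imp_le[OF c0]]]
    by (simp add: AE_all_countable)
  moreover have "AE \<omega> in M. \<forall>i n. 0 < P n \<omega> \<longrightarrow>
      (\<forall>t\<ge>n. y i * \<theta> t \<omega> \<le> P t \<omega> \<and> c i * \<theta> t \<omega> \<le> \<delta> t \<omega>) \<longrightarrow>
      (\<exists>K::nat. \<forall>t\<ge>n. 1 < Suc K * P t \<omega>)"
    using AE_bounded_away_from_0[OF c0 y2 cy] by (simp add: AE_all_countable)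
  moreover note AE_summable_hazard AE_space sum ratio
  ultimately show ?thesis
  proof eventually_elim
    case (elim \<omega>)
    note range = elim(1) and shrink = elim(2) and compl = elim(3) and ex = elim(4)
      and away = elim(5) and hazard_sum = elim(6) and space = elim(7) and diverges = elim(8)
    show ?case
    proof (rule ccontr)
      assume contra: "\<not> (\<lambda>t. P t \<omega>) \<longlonglongrightarrow> 1"
      have "\<not> (\<lambda>t. 1 - P t \<omega>) \<longlonglongrightarrow> 0"
      proof
        assume "(\<lambda>t. 1 - P t \<omega>) \<longlonglongrightarrow> 0"
        from tendsto_diff[OF tendsto_const this, of 1] contra show False by simp
      qed
      \<comment> \<open>A path of \<open>1 - P\<close> with infimum 0 would converge to 0, so this
        path has a positive lower bound.\<close>
      then obtain j where "\<forall>T. \<not> 1 - P T \<omega> \<le> c j" using compl space by (auto simp: c_def)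
      then have j: "P T \<omega> \<le> 1 - c j" for T by (simp add: algebra_simps not_le less_imp_le)
      obtain c' where c': "c' > 0" "\<forall>t. c' * \<theta> t \<omega> \<le> \<delta> t \<omega>" using elim(9) by blast
      obtain i where "c i < c'" using nat_approx_posE[OF c'(1)] by (auto simp: c_def)
      then have i: "c i * \<theta> t \<omega> \<le> \<delta> t \<omega>" for t
        using c'(2) range by (meson atLeastAtMost_iff greaterThanAtMost_iff less_imp_le mult_right_mono order.trans)
      define r where "r = c i * c j"
      have r: "r > 0" using c0 by (simp add: r_def)
      have "\<exists>T. exp (- (r * P T \<omega> / \<theta> T \<omega>)) \<le> 1 / Suc m" for m
      proof -
        \<comment> \<open>\<open>k\<close> is large enough that
          \<open>P T / \<theta> T \<ge> k\<close> forces the exponential down to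
          \<open>1 / Suc m\<close>; the shrinking condition provides such a
          \<open>T\<close>.\<close>
        obtain k :: nat where "ln (Suc m) / r \<le> k" using real_arch_simple by blast
        then have k: "ln (Suc m) \<le> r * k" using r by (simp add: field_simps)
        obtain T where T: "k * \<theta> T \<omega> \<le> P T \<omega>" using shrink by blast
        then have "k \<le> P T \<omega> / \<theta> T \<omega>" using range by (simp add: pos_le_divide_eq)
        then have "r * k \<le> r * (P T \<omega> / \<theta> T \<omega>)" using r by (intro mult_left_mono) auto
        then have "exp (- (r * P T \<omega> / \<theta> T \<omega>)) \<le> exp (- ln (Suc m))" using k by simp
        also have "\<dots> = 1 / Suc m" by (simp add: exp_minus field_simps)
        finally show ?thesis by blast
      qed
      then have "(\<lambda>t. exp (- (r * P t \<omega> / \<theta> t \<omega>))) \<longlonglongrightarrow> 0"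
        using ex i j space unfolding r_def by blast
      \<comment> \<open>Convergence to 0 means that \<open>P / \<theta>\<close> eventually stays
        above every level, in particular above the threshold \<open>y i\<close> of the reciprocal
        estimate.\<close>
      then have "\<forall>\<^sub>F t in sequentially. exp (- (r * P t \<omega> / \<theta> t \<omega>)) < exp (- (r * y i))"
        by (rule order_tendstoD) simp
      then obtain n where "\<forall>t\<ge>n. exp (- (r * P t \<omega> / \<theta> t \<omega>)) < exp (- (r * y i))"
        by (auto simp: eventually_sequentially)
      then have large: "y i * \<theta> t \<omega> \<le> P t \<omega>" if "t \<ge> n" for t
        using that r range[rule_format, of t] by (auto simp: field_simps dest!: spec[of _ t])
      have "0 < y i * \<theta> n \<omega>" using y2[of i] range by (intro mult_pos_pos) auto
      then have "0 < P n \<omega>" using large[of n] by simp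
      then obtain K :: nat where K: "\<forall>t\<ge>n. 1 < Suc K * P t \<omega>" using away large i by blast
      \<comment> \<open>From time \<open>n\<close> on, \<open>P\<close> and \<open>1 - P\<close> are
        at least \<open>1 / Suc K\<close> and \<open>1 / Suc j\<close>, so the summable drift
        dominates a constant multiple of \<open>\<delta>\<close>.\<close>
      have "summable (\<lambda>t. \<delta> t \<omega>)"
      proof (rule summable_comparison_test')
        show "summable (\<lambda>t. real (Suc K) * real (Suc j) * (\<delta> t \<omega> * P t \<omega> * (1 - P t \<omega>)))"
          using hazard_sum by (rule summable_mult)
        fix t assume t: "n \<le> t"
        have "1 \<le> Suc j * (1 - P t \<omega>)" using j[of t] by (simp add: c_def field_simps)
        then have "1 * 1 \<le> (Suc K * P t \<omega>) * (Suc j * (1 - P t \<omega>))"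
          using K t by (intro mult_mono') (auto simp: less_imp_le)
        then have "\<delta> t \<omega> * 1 \<le> \<delta> t \<omega> * ((Suc K * P t \<omega>) * (Suc j * (1 - P t \<omega>)))"
          using range by (intro mult_left_mono) (auto simp: less_imp_le)
        also have "\<dots> = real (Suc K) * real (Suc j) * (\<delta> t \<omega> * P t \<omega> * (1 - P t \<omega>))"
          by (simp only: mult_ac)
        finally show "norm (\<delta> t \<omega>) \<le> real (Suc K) * real (Suc j) * (\<delta> t \<omega> * P t \<omega> * (1 - P t \<omega>))"
          using range by (simp only: real_norm_def abs_of_pos mult_1_right)
      qed
      with diverges show False ..
    qed
  qed
qed

end

section \<open>Application to the coordinate filtration\<close>

text \<open>Restriction to \<open>{1..t}\<close> factors through restriction to
  \<open>{1..Suc t}\<close>.\<close>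

lemma sets_coord_filtration_mono:
  "sets (coord_filtration S t) \<subseteq> sets (coord_filtration S (Suc t))"
proof
  fix B assume "B \<in> sets (coord_filtration S t)"
  then obtain A where A: "A \<in> sets (PiM {1..t} S)"
    "B = (\<lambda>\<omega>. restrict \<omega> {1..t}) -` A \<inter> space (PiM {1..} S)"
    unfolding sets_coord_filtration by blast
  let ?A = "(\<lambda>\<omega>. restrict \<omega> {1..t}) -` A \<inter> space (PiM {1..Suc t} S)"
  have "(\<lambda>\<omega>. restrict \<omega> {1..t}) \<in> PiM {1..Suc t} S \<rightarrow>\<^sub>M PiM {1..t} S"
    by (rule measurable_restrict_subset) auto
  then have "?A \<in> sets (PiM {1..Suc t} S)" using A(1) by (rule measurable_sets)
  moreover have "B = (\<lambda>\<omega>. restrict \<omega> {1..Suc t}) -` ?A \<inter> space (PiM {1..} S)"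
    using A(2) by (auto simp: space_PiM PiE_iff restrict_restrict Int_absorb1)
  ultimately show "B \<in> sets (coord_filtration S (Suc t))"
    unfolding sets_coord_filtration by blast
qed

theorem theorem2p2:
  fixes S :: "nat \<Rightarrow> 'a measure"
    and M :: "(nat \<Rightarrow> 'a) measure"
    and P \<delta> \<theta> :: "nat \<Rightarrow> (nat \<Rightarrow> 'a) \<Rightarrow> real"
    and \<delta>' :: "(nat \<Rightarrow> 'a) \<Rightarrow> real"
  assumes prob: "prob_space M"
    and sets_M: "sets M = sets (PiM {1..} S)"
    and P_adapted: "\<And>t. P t \<in> borel_measurable (coord_filtration S t)"
    and P_range: "\<And>t. AE \<omega> in M. P t \<omega> \<in> {0..1}"
    and \<delta>_meas: "\<And>t. \<delta> t \<in> borel_measurable (coord_filtration S t)"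
    and \<delta>_pos: "\<And>t. AE \<omega> in M. \<delta> t \<omega> > 0"
    and hazard: "\<And>t. AE \<omega> in M.
      real_cond_exp M (coord_filtration S t) (P (t + 1)) \<omega> - P t \<omega>
        \<ge> \<delta> t \<omega> * P t \<omega> * (1 - P t \<omega>)"
    and \<delta>_sum: "AE \<omega> in M. (\<Sum>t. ereal (\<delta> t \<omega>)) = \<infinity>"
    and \<delta>'_meas: "\<delta>' \<in> borel_measurable M"
    and \<delta>'_pos: "AE \<omega> in M. \<delta>' \<omega> > 0"
    and \<theta>_meas: "\<And>t. \<theta> t \<in> borel_measurable (coord_filtration S t)"
    and \<theta>_range: "\<And>t. AE \<omega> in M. \<theta> t \<omega> \<in> {0<..1}"
    and \<theta>_decseq: "AE \<omega> in M. decseq (\<lambda>t. \<theta> t \<omega>)"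
    and stretch: "\<And>t. AE \<omega> in M.
      - P t \<omega> \<le> 1 / \<theta> t \<omega> * (P (t + 1) \<omega> - P t \<omega>) \<and>
      1 / \<theta> t \<omega> * (P (t + 1) \<omega> - P t \<omega>) \<le> 1 - P t \<omega>"
    and ratio: "\<And>t. AE \<omega> in M. \<delta> t \<omega> / \<theta> t \<omega> > \<delta>' \<omega>"
    and shrink: "\<And>y. AE \<omega> in M. reach_time P \<theta> y \<omega> < \<infinity>"
  shows "AE \<omega> in M. (\<lambda>t. P t \<omega>) \<longlonglongrightarrow> 1"
proof -
  interpret prob_space M by (rule prob)
  have \<theta>_pos: "AE \<omega> in M. \<forall>t. 0 < \<theta> t \<omega>" and \<delta>_pos': "AE \<omega> in M. \<forall>t. 0 < \<delta> t \<omega>"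
    and ratio': "AE \<omega> in M. \<forall>t. \<delta>' \<omega> < \<delta> t \<omega> / \<theta> t \<omega>"
    unfolding AE_all_countable using \<theta>_range \<delta>_pos ratio by auto
  interpret hazard_process M "coord_filtration S" P \<delta> \<theta>
  proof unfold_locales
    fix t
    show "subalgebra M (coord_filtration S t)" by (rule subalgebra_coord_filtration[OF sets_M])
    show "AE \<omega> in M. \<theta> (Suc t) \<omega> \<le> \<theta> t \<omega>"
      using \<theta>_decseq by eventually_elim (simp add: decseq_Suc_iff)
    show "AE \<omega> in M. - P t \<omega> \<le> (P (Suc t) \<omega> - P t \<omega>) / \<theta> t \<omega> \<and>
      (P (Suc t) \<omega> - P t \<omega>) / \<theta> t \<omega> \<le> 1 - P t \<omega>"
      using stretch[of t] by simp
    show "AE \<omega> in M. real_cond_exp M (coord_filtration S t) (P (Suc t)) \<omega> - P t \<omega>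
      \<ge> \<delta> t \<omega> * P t \<omega> * (1 - P t \<omega>)"
      using hazard[of t] by simp
  qed (fact sets_coord_filtration_mono P_adapted \<delta>_meas \<theta>_meas P_range \<delta>_pos \<theta>_range)+
  show ?thesis
  proof (rule AE_tendsto_1)
    show "AE \<omega> in M. \<not> summable (\<lambda>t. \<delta> t \<omega>)"
      using \<delta>_sum
    proof eventually_elim
      case (elim \<omega>)
      show ?case
      proof
        \<comment> \<open>A real sum would also be the extended real sum, which is infinite.\<close>
        assume "summable (\<lambda>t. \<delta> t \<omega>)"
        then have "(\<lambda>t. ereal (\<delta> t \<omega>)) sums ereal (\<Sum>t. \<delta> t \<omega>)"
          unfolding sums_ereal by (rule summable_sums)
        from sums_unique[OF this] elim show False by (metis PInfty_neq_ereal(1))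
      qed
    qed
    show "AE \<omega> in M. \<exists>c>0. \<forall>t. c * \<theta> t \<omega> \<le> \<delta> t \<omega>"
      \<comment> \<open>The pathwise constant is \<open>\<delta>' \<omega>\<close>.\<close>
      using \<delta>'_pos \<theta>_pos ratio'
      by eventually_elim (auto simp: pos_less_divide_eq less_imp_le)
    show "AE \<omega> in M. \<exists>t. y * \<theta> t \<omega> \<le> P t \<omega>" for y
      using shrink[of y] unfolding reach_time_finite_iff .
  qed
qed

end
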